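(* Let $K^\pm_m$ ($\pm m\ge0$) be the generators of $\mathcal{SV}ir_{q,k}$ of that name, let $K^\pm(z)=\sum_{\pm m\ge0}K^\pm_mz^{-m}$, and define elements $H_m$ ($m\in\mathbb Z$, $m\neq0$) by $$\exp\Bigl((q-q^{-1})\sum_{m>0}H_{\pm m}z^{\mp m}\Bigr)=(K_0^\pm)^{-1}K^\pm(z)=1+\sum_{m>0}(K_0^\pm)^{-1}K^\pm_{\pm m}z^{\mp m}.$$ Then the Heisenberg commutation relations hold: $$[H_m,H_n]=\frac{[(k+2)m][km]}{m}\,\delta_{m+n,0}.$$
   Context: $q,k$ are generic complex numbers with $|q|\le1$, $|q^k|\le1$; $k\ne-2$, $q$ not a root of unity; $[u]=(q^u-q^{-u})/(q-q^{-1})$ for a number $u$, and $[a,b]=ab-ba$. $\mathcal{SV}ir_{q,k}$ is a unital associative algebra with generators $K^\pm_m$ ($\pm m\ge0$), $T_m$, $G^\pm_m$. The defining relations among the $K^\pm_m$ alone are (with $K^\pm_m=0$ for $\mp m>0$): $K_0^+=K_0^-$, and $K_0^\pm$ are invertible; $K^\pm_mK^\pm_n=K^\pm_nK^\pm_m$; $K^-_mK^+_n=K^+_nK^-_m-(q-q^{-1})^2\sum_{\ell=1}^{-m}\frac{[k][k+2][2\ell]}{[2]}K^+_{n-\ell}K^-_{m+\ell}$. Equivalently, $K^-(z)K^+(w)=\frac{(1-q^{2k+2}z/w)(1-q^{-2k-2}z/w)}{(1-q^2z/w)(1-q^{-2}z/w)}K^+(w)K^-(z)$, expanded in $|z|\ll|w|$,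 together with $K^\pm(z)K^\pm(w)=K^\pm(w)K^\pm(z)$. *)

theory Defs
  imports Complex_Main "HOL-Computational_Algebra.Formal_Power_Series"
begin

unbundle fps_syntax

text \<open>Complex powers of \<^term>\<open>q\<close> depend on a choice of logarithm \<^term>\<open>l\<close> of \<^term>\<open>q\<close>,
  which is kept as an explicit parameter, so that no branch is preferred.\<close>

definition qpow :: "complex \<Rightarrow> complex \<Rightarrow> complex" where
  "qpow l u = exp (u * l)"

definition qnum :: "complex \<Rightarrow> complex \<Rightarrow> complex" where
  "qnum l u = (qpow l u - qpow l (- u)) / (qpow l 1 - qpow l (- 1))"

locale complex_algebra = vector_space scale
  for scale :: "complex \<Rightarrow> 'a::ring_1 \<Rightarrow> 'a" +
  assumes scale_mult_left: "scale c x * y = scale c (x * y)"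
    and scale_mult_right: "x * scale c y = scale c (x * y)"

text \<open>A complex unital associative algebra with elements \<^term>\<open>Kp m\<close> and \<^term>\<open>Km m\<close>
  (for $K^+_m$ and $K^-_m$) satisfying the defining relations of the superconformal algebra that
  involve these generators only. The presented algebra is an instance, whatever its
  further generators and relations are. The element \<^term>\<open>K0inv\<close> is the inverse of
  $K^+_0 = K^-_0$. In the last relation the sum is empty for \<^prop>\<open>m \<ge> 0\<close>.\<close>

locale svir_K = complex_algebra scale
  for scale :: "complex \<Rightarrow> 'a::ring_1 \<Rightarrow> 'a" +
  fixes q l k :: complex
    and Kp Km :: "int \<Rightarrow> 'a"
    and K0inv :: 'a
  assumes Kp_neg: "m < 0 \<Longrightarrow> Kp m = 0"
    and Km_pos: "m > 0 \<Longrightarrow> Km m = 0"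
    and K0_eq: "Kp 0 = Km 0"
    and K0_inverse: "Kp 0 * K0inv = 1" "K0inv * Kp 0 = 1"
    and Kp_comm: "Kp m * Kp n = Kp n * Kp m"
    and Km_comm: "Km m * Km n = Km n * Km m"
    and Km_Kp: "Km m * Kp n = Kp n * Km m
      - scale ((q - inverse q)\<^sup>2)
          (\<Sum>j\<in>{1..-m}. scale (qnum l k * qnum l (k + 2) * qnum l (2 * of_int j) / qnum l 2)
                            (Kp (n - j) * Km (m + j)))"

text \<open>The exponential of a formal power series without constant term, with coefficients in a
  possibly noncommutative algebra, is the composition with $\sum_n X^n / n!$. The library's
  \<open>fps_exp\<close> needs coefficients in a field.\<close>

definition alg_fps_exp :: "(complex \<Rightarrow> 'a::ring_1 \<Rightarrow> 'a) \<Rightarrow> 'a fps \<Rightarrow> 'a fps" where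
  "alg_fps_exp scale A = fps_compose (Abs_fps (\<lambda>n. scale (1 / fact n) 1)) A"

text \<open>The exponential has a unique logarithm: an equation of this shape does
  define the coefficients of its exponent.\<close>

lemma fps_power_nth_cong:
  fixes A B :: "'a::ring_1 fps"
  assumes "\<And>i. i < n \<Longrightarrow> A $ i = B $ i" and "A $ 0 = 0" and "B $ 0 = 0" and "j \<noteq> 1"
  shows "(A ^ j) $ n = (B ^ j) $ n"
proof -
  have agree: "(A ^ j) $ i = (B ^ j) $ i" if "i < n" for i j
    using that
  proof (induction j arbitrary: i)
    case (Suc j)
    then show ?case
      by (simp add: fps_mult_nth assms(1))
  qed simp
  show ?thesis
  proof (cases j)
    case (Suc j')
    with \<open>j \<noteq> 1\<close> have zero: "(A ^ j') $ 0 = 0" "(B ^ j') $ 0 = 0"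
      using assms(2,3) by (simp_all add: fps_power_zeroth zero_power)
    have "A $ i * (A ^ j') $ (n - i) = B $ i * (B ^ j') $ (n - i)" if "i \<le> n" for i
    proof -
      consider "i = 0" | "i = n" | "0 < i" "i < n" using \<open>i \<le> n\<close> by linarith
      then show ?thesis
      proof cases
        case 3
        then show ?thesis using assms(1)[of i] agree[of "n - i" j'] by simp
      qed (use assms zero in auto)
    qed
    then show ?thesis
      by (simp add: Suc fps_mult_nth)
  qed simp
qed

lemma (in complex_algebra) alg_fps_exp_nth_diff:
  assumes "\<And>i. i < n \<Longrightarrow> A $ i = B $ i" and "A $ 0 = 0" and "B $ 0 = 0"
  shows "alg_fps_exp scale A $ n - alg_fps_exp scale B $ n = A $ n - B $ n"
proof -
  have "alg_fps_exp scale A $ n - alg_fps_exp scale B $ n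
      = (\<Sum>j=0..n. scale (1 / fact j) 1 * ((A ^ j) $ n - (B ^ j) $ n))"
    by (simp add: alg_fps_exp_def fps_compose_nth sum_subtractf right_diff_distrib)
  also have "\<dots> = (\<Sum>j=0..n. if j = 1 then A $ n - B $ n else 0)"
    by (rule sum.cong) (use fps_power_nth_cong[OF assms] in auto)
  also have "\<dots> = A $ n - B $ n"
    using assms by (cases n) auto
  finally show ?thesis .
qed

lemma (in complex_algebra) alg_fps_exp_ex1:
  assumes "F $ 0 = 1"
  shows "\<exists>!A. A $ 0 = 0 \<and> alg_fps_exp scale A = F"
proof (rule ex_ex1I)
  have "\<exists>h. \<forall>n. h n = (if n = 0 then 0
      else F $ n - alg_fps_exp scale (Abs_fps (\<lambda>i. if i < n then h i else 0)) $ n)"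
  proof -
    define step where "step h n = (if n = 0 then 0
      else F $ n - alg_fps_exp scale (Abs_fps (\<lambda>i. if i < n then h i else 0)) $ n)"
      for h :: "nat \<Rightarrow> 'a" and n
    have "step g n = step h n" if "\<forall>i<n. g i = h i" for g h n
    proof -
      have "(\<lambda>i. if i < n then g i else 0) = (\<lambda>i. if i < n then h i else 0)"
        using that by (simp add: fun_eq_iff)
      then show ?thesis by (simp only: step_def)
    qed
    then have "adm_wf less_than step" by (simp add: adm_wf_def)
    from wfrec_fixpoint[OF wf_less_than this] show ?thesis
      by (intro exI[of _ "wfrec less_than step"] allI) (metis step_def)
  qed
  then obtain h where h: "\<And>n. h n = (if n = 0 then 0
      else F $ n - alg_fps_exp scale (Abs_fps (\<lambda>i. if i < n then h i else 0)) $ n)"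
    by blast
  have h0: "h 0 = 0" by (subst h) simp
  have "alg_fps_exp scale (Abs_fps h) $ n = F $ n" for n
  proof (cases "n = 0")
    case True
    then show ?thesis using assms by (simp add: alg_fps_exp_def fps_compose_nth)
  next
    case False
    have "alg_fps_exp scale (Abs_fps h) $ n
        - alg_fps_exp scale (Abs_fps (\<lambda>i. if i < n then h i else 0)) $ n = h n"
      by (subst alg_fps_exp_nth_diff) (auto simp: h0)
    then show ?thesis using h[of n] False by (simp add: algebra_simps)
  qed
  then show "\<exists>A. A $ 0 = 0 \<and> alg_fps_exp scale A = F"
    by (intro exI[of _ "Abs_fps h"]) (simp add: h0 fps_eq_iff)
next
  fix A B
  assume A: "A $ 0 = 0 \<and> alg_fps_exp scale A = F" and B: "B $ 0 = 0 \<and> alg_fps_exp scale B = F"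
  have "A $ n = B $ n" for n
  proof (induction n rule: less_induct)
    case (less n)
    with A B alg_fps_exp_nth_diff[of n A B] show ?case by simp
  qed
  then show "A = B" by (simp add: fps_eq_iff)
qed

end

(* Write K^-(z) = K_0 exp(A(z)) and K^+(w) = K_0 exp(B(w)). The normalized currents M = exp(A) and
   P = exp(B) satisfy M(z) P(w) = f(z/w) P(w) M(z) with f = exp(g) a scalar series. Since the
   coefficients of A commute with each other, M' = A' M, and differentiating in z gives
   [A', P] = g' P. Differentiating this in w, with P' = B' P, gives that the commutator of A' and B'
   is the mixed second derivative of the scalar g(z/w). The coefficients of g = log f come from
   the factors 1 - u x of the numerator and denominator of f, each of which has a geometric series
   as logarithmic derivative. Throughout, the formal variable for K^+ is the inverse of the
   paper's w, so that z/w becomes a product. *)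

theory Submission
  imports Defs
begin

section \<open>Cancellation and differentiation of power series over a noncommutative ring\<close>

text \<open>The coefficient ring may have zero divisors; cancellation works because a series with
  constant term 1 has a right inverse.\<close>

lemma fps_mult_cancel_right:
  fixes X Y Z :: "'a::ring_1 fps"
  assumes "X * Z = Y * Z" and "Z $ 0 = 1"
  shows "X = Y"
proof -
  have inv: "Z * fps_right_inverse Z 1 = 1"
    by (rule fps_right_inverse) (simp add: assms(2))
  have "X = X * Z * fps_right_inverse Z 1"
    by (simp add: mult.assoc inv)
  also have "\<dots> = Y"
    by (simp add: assms(1)) (simp add: mult.assoc inv)
  finally show ?thesis .
qed

lemma fps_mult_commute_coeffs:
  fixes F G :: "'a::semiring_1 fps"
  assumes "\<And>i j. F $ i * G $ j = G $ j * F $ i"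
  shows "F * G = G * F"
proof (rule fps_ext)
  fix n
  show "(F * G) $ n = (G * F) $ n"
    unfolding fps_mult_nth
    by (rule sum.reindex_bij_witness[of _ "\<lambda>i. n - i" "\<lambda>i. n - i"]) (auto simp: assms)
qed

text \<open>The product rule gives the sum of \<open>A ^ i * fps_deriv A * A ^ (n - 1 - i)\<close>;
  commutation brings each derivative to the front. At n = 0 the truncated exponent is harmless, as
  the factor \<open>of_nat n\<close> vanishes.\<close>

lemma fps_power_deriv_commuting:
  fixes A :: "'a::ring_1 fps"
  assumes "fps_deriv A * A = A * fps_deriv A"
  shows "fps_deriv (A ^ n) = of_nat n * (fps_deriv A * A ^ (n - 1))"
proof (induction n)
  case (Suc n)
  have "A * (of_nat n * (fps_deriv A * A ^ (n - 1))) = of_nat n * (fps_deriv A * A ^ n)"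
  proof (cases n)
    case (Suc m)
    have "A * (of_nat n * (fps_deriv A * A ^ m)) = of_nat n * (A * fps_deriv A * A ^ m)"
      by (metis mult.assoc mult_of_nat_commute)
    then show ?thesis
      by (simp add: Suc assms[symmetric] mult.assoc)
  qed simp
  then show ?case
    by (simp add: Suc.IH distrib_right add.commute)
qed simp

lemma fps_const_sum: "fps_const (\<Sum>i\<in>I. f i) = (\<Sum>i\<in>I. fps_const (f i))"
  by (rule fps_ext) (simp add: fps_sum_nth)

text \<open>Embeds the series in $z$ into the series in $z$ whose coefficients are series in $w$.\<close>

definition const_coeffs :: "'a::zero fps \<Rightarrow> 'a fps fps" where
  "const_coeffs F = Abs_fps (\<lambda>n. fps_const (F $ n))"

lemma const_coeffs_nth [simp]: "const_coeffs F $ n = fps_const (F $ n)"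
  by (simp add: const_coeffs_def)

lemma const_coeffs_mult: "const_coeffs (F * G) = const_coeffs F * const_coeffs G"
  for F G :: "'a::ring_1 fps"
  by (rule fps_ext) (simp add: fps_mult_nth fps_const_sum)

lemma fps_deriv_const_coeffs: "fps_deriv (const_coeffs F) = const_coeffs (fps_deriv F)"
  for F :: "'a::ring_1 fps"
  by (rule fps_ext) (simp add: fps_of_nat[symmetric] del: of_nat_Suc of_nat_add)

section \<open>Exponential series over a complex algebra\<close>

context complex_algebra
begin

lemma scale_eq_mult: "scale c x = scale c 1 * x"
  by (simp add: scale_mult_left)

lemma scale_one_central: "scale c 1 * x = x * scale c 1"
  by (simp add: scale_mult_left scale_mult_right)

lemma scale_one_mult: "scale c 1 * scale d 1 = scale (c * d) 1"
  by (simp add: scale_mult_left)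

lemma scale_of_nat_one: "scale (of_nat n) 1 = of_nat n"
  by (induction n) (simp_all add: scale_left_distrib)

lemma of_nat_mult_eq_scale: "of_nat n * x = scale (of_nat n) x"
  by (simp add: scale_eq_mult[of _ x] scale_of_nat_one)

lemma alg_fps_exp_nth: "alg_fps_exp scale A $ n = (\<Sum>i=0..n. scale (1 / fact i) ((A ^ i) $ n))"
  by (simp add: alg_fps_exp_def fps_compose_nth scale_mult_left)

lemma alg_fps_exp_nth_commute:
  assumes "\<And>i. A $ i * x = x * A $ i"
  shows "alg_fps_exp scale A $ n * x = x * alg_fps_exp scale A $ n"
proof -
  have "A * fps_const x = fps_const x * A"
    by (rule fps_ext) (simp add: assms)
  then have "A ^ j * fps_const x = fps_const x * A ^ j" for j
    by (rule power_commuting_commutes)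
  then have "(A ^ j) $ n * x = x * (A ^ j) $ n" for j
    by (metis fps_mult_left_const_nth fps_mult_right_const_nth)
  then show ?thesis
    by (simp add: alg_fps_exp_nth sum_distrib_left sum_distrib_right
        scale_mult_left scale_mult_right)
qed

text \<open>Converse of the preceding transfer. The n-th coefficient of the exponential is
  \<open>A $ n\<close> plus that of the exponential of the truncation \<open>?T\<close>, which
  involves lower coefficients only; hence the induction.\<close>

lemma commute_of_alg_fps_exp_commute:
  assumes "A $ 0 = 0"
    and "\<And>n. alg_fps_exp scale A $ n * x = x * alg_fps_exp scale A $ n"
  shows "A $ n * x = x * A $ n"
proof (induction n rule: less_induct)
  case (less n)
  let ?T = "Abs_fps (\<lambda>i. if i < n then A $ i else 0)"
  have "alg_fps_exp scale A $ n - alg_fps_exp scale ?T $ n = A $ n - ?T $ n"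
    by (rule alg_fps_exp_nth_diff) (use assms(1) in auto)
  then have "A $ n = alg_fps_exp scale A $ n - alg_fps_exp scale ?T $ n"
    by simp
  moreover have "alg_fps_exp scale ?T $ n * x = x * alg_fps_exp scale ?T $ n"
    by (rule alg_fps_exp_nth_commute) (auto simp: less.IH)
  ultimately show ?case
    by (simp add: assms(2) left_diff_distrib right_diff_distrib)
qed

text \<open>The transfer is applied twice: first against coefficients of the exponential, then
  against those of \<open>A\<close>.\<close>

lemma commute_coeffs_of_alg_fps_exp_commute:
  assumes "A $ 0 = 0"
    and "\<And>m n. alg_fps_exp scale A $ m * alg_fps_exp scale A $ n
               = alg_fps_exp scale A $ n * alg_fps_exp scale A $ m"
  shows "A $ m * A $ n = A $ n * A $ m"
proof -
  have "A $ i * alg_fps_exp scale A $ j = alg_fps_exp scale A $ j * A $ i" for i j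
    by (rule commute_of_alg_fps_exp_commute[OF assms])
  then show ?thesis
    by (intro commute_of_alg_fps_exp_commute[OF assms(1)]) simp
qed

lemma fps_deriv_alg_fps_exp:
  assumes A0: "A $ 0 = 0" and comm: "\<And>i j. A $ i * A $ j = A $ j * A $ i"
  shows "fps_deriv (alg_fps_exp scale A) = fps_deriv A * alg_fps_exp scale A"
proof (rule fps_ext)
  fix n
  have "A $ i * (of_nat j * A $ j) = of_nat j * A $ j * A $ i" for i j
    by (metis comm mult.assoc mult_of_nat_commute)
  then have "fps_deriv A * A = A * fps_deriv A"
    by (intro fps_mult_commute_coeffs) (simp add: comm mult.assoc del: of_nat_Suc of_nat_add)
  note deriv = fps_power_deriv_commuting[OF this]
  have deriv_nth: "scale (of_nat (n + 1)) ((A ^ i) $ (n + 1))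
      = scale (of_nat i) ((fps_deriv A * A ^ (i - 1)) $ n)" for i
    using arg_cong[OF deriv[of i], of "\<lambda>F. F $ n"]
    by (simp add: of_nat_mult_eq_scale[symmetric] fps_of_nat[symmetric] del: of_nat_Suc of_nat_add)
  have term_nth: "scale (of_nat (n + 1)) (scale (1 / fact i) ((A ^ i) $ (n + 1)))
      = scale (1 / fact i * of_nat i) ((fps_deriv A * A ^ (i - 1)) $ n)" for i
    by (subst scale_left_commute) (simp only: deriv_nth scale_scale)
  have fact: "1 / fact (Suc i) * of_nat (Suc i) = (1 / fact i :: complex)" for i
    by (simp del: of_nat_Suc)
  have "fps_deriv (alg_fps_exp scale A) $ n
      = (\<Sum>i=0..Suc n. scale (1 / fact i * of_nat i) ((fps_deriv A * A ^ (i - 1)) $ n))"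
    unfolding fps_deriv_nth of_nat_mult_eq_scale alg_fps_exp_nth scale_sum_right
    by (simp only: term_nth Suc_eq_plus1)
  \<comment> \<open>The term i = 0 carries the factor 0; shifting the index turns i / i! into 1 / (i
    - 1)!.\<close>
  also have "\<dots> = (\<Sum>i=0..n. scale (1 / fact i) ((fps_deriv A * A ^ i) $ n))"
    unfolding sum.atLeast0_atMost_Suc_shift fact o_def by simp
  also have "\<dots> = (\<Sum>i=0..n. \<Sum>j=0..n. fps_deriv A $ j * scale (1 / fact i) ((A ^ i) $ (n - j)))"
    unfolding fps_mult_nth scale_sum_right scale_mult_right ..
  also have "\<dots> = (\<Sum>j=0..n. \<Sum>i=0..n. fps_deriv A $ j * scale (1 / fact i) ((A ^ i) $ (n - j)))"
    by (rule sum.swap)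
  also have "\<dots> = (\<Sum>j=0..n. fps_deriv A $ j * alg_fps_exp scale A $ (n - j))"
  proof (rule sum.cong[OF refl])
    fix j
    assume "j \<in> {0..n}"
    \<comment> \<open>\<open>A ^ i\<close> has no terms below degree i, so the upper limit may drop
      from n to n - j.\<close>
    have "(\<Sum>i=0..n. scale (1 / fact i) ((A ^ i) $ (n - j)))
        = (\<Sum>i=0..n - j. scale (1 / fact i) ((A ^ i) $ (n - j)))"
      by (rule sum.mono_neutral_right) (auto simp: startsby_zero_power_prefix[OF A0, rule_format])
    then show "(\<Sum>i=0..n. fps_deriv A $ j * scale (1 / fact i) ((A ^ i) $ (n - j)))
        = fps_deriv A $ j * alg_fps_exp scale A $ (n - j)"
      by (simp only: alg_fps_exp_nth sum_distrib_left[symmetric])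
  qed
  finally show "fps_deriv (alg_fps_exp scale A) $ n = (fps_deriv A * alg_fps_exp scale A) $ n"
    by (simp add: fps_mult_nth)
qed

section \<open>From an exchange relation to a commutator\<close>

text \<open>The coefficient of z^j in f(zw) is \<open>monom_scalar (f $ j) j\<close>, a series in w
  over the algebra; its scalar enters as a multiple of 1 and is therefore central.\<close>

definition monom_scalar :: "complex \<Rightarrow> nat \<Rightarrow> 'a fps" where
  "monom_scalar c n = fps_const (scale c 1) * fps_X ^ n"

lemma monom_scalar_nth: "monom_scalar c n $ i = (if i = n then scale c 1 else 0)"
  by (simp add: monom_scalar_def fps_X_power_nth)

lemma monom_scalar_central: "monom_scalar c n * Y = Y * monom_scalar c n"
  by (rule fps_mult_commute_coeffs) (simp add: monom_scalar_nth scale_one_central)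

lemma monom_scalar_mult: "monom_scalar c m * monom_scalar d n = monom_scalar (c * d) (m + n)"
proof -
  have "monom_scalar c m * monom_scalar d n
      = fps_const (scale c 1) * (fps_X ^ m * fps_const (scale d 1)) * fps_X ^ n"
    by (simp add: monom_scalar_def mult.assoc)
  also have "\<dots> = monom_scalar (c * d) (m + n)"
    by (simp add: fps_mult_fps_X_power_commute monom_scalar_def)
       (simp add: scale_one_mult power_add flip: mult.assoc)
  finally show ?thesis .
qed

lemma monom_scalar_mult_nth:
  "(monom_scalar c m * Y) $ n = (if n < m then 0 else scale c (Y $ (n - m)))"
  by (simp add: monom_scalar_def mult.assoc fps_X_power_mult_nth scale_mult_left)

lemma monom_scalar_sum: "monom_scalar (\<Sum>i\<in>I. c i) n = (\<Sum>i\<in>I. monom_scalar (c i) n)"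
  by (rule fps_ext) (simp add: monom_scalar_nth fps_sum_nth scale_sum_left)

lemma of_nat_mult_monom_scalar: "of_nat N * monom_scalar c n = monom_scalar (of_nat N * c) n"
  by (rule fps_ext)
     (simp add: monom_scalar_nth of_nat_mult_eq_scale flip: fps_of_nat)

lemma alg_fps_exp_zeroth: "alg_fps_exp scale A $ 0 = 1"
  by (simp add: alg_fps_exp_nth)

text \<open>The hypothesis says that $M(z) P(w) = f(zw) P(w) M(z)$, with outer variable $z$ and inner
  variable $w$. In the proof, $F$ is $f(zw)$ and $G$ is its logarithmic derivative in $z$; the
  conclusion is the coefficient of $z^a$ in $[A'(z), P(w)] = G P(w)$.\<close>

lemma exchange_deriv:
  fixes A P M :: "'a fps" and f g :: "complex fps"
  assumes M0: "M $ 0 = 1" and dM: "fps_deriv M = fps_deriv A * M"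
    and exch: "\<And>a n. M $ a * P $ n = (\<Sum>j=0..min a n. scale (f $ j) (P $ (n - j) * M $ (a - j)))"
    and fg: "fps_deriv f = fps_deriv g * f" and f0: "f $ 0 = 1"
  shows "fps_const (fps_deriv A $ a) * P
    = P * fps_const (fps_deriv A $ a) + monom_scalar (fps_deriv g $ a) (Suc a) * P"
proof -
  define F where "F = Abs_fps (\<lambda>j. monom_scalar (f $ j) j)"
  \<comment> \<open>The z-derivative of g(zw) is w g'(zw), whence the exponent
    \<open>Suc j\<close>.\<close>
  define G where "G = Abs_fps (\<lambda>j. monom_scalar (fps_deriv g $ j) (Suc j))"
  define D where "D = fps_deriv (const_coeffs A)"
  let ?M = "const_coeffs M" and ?P = "fps_const P"
  have F_central: "F * Y = Y * F" for Y
    by (rule fps_mult_commute_coeffs) (simp add: F_def monom_scalar_central)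
  have dF: "fps_deriv F = G * F"
  proof (rule fps_ext)
    fix n
    have "fps_deriv F $ n = monom_scalar (of_nat (n + 1) * f $ (n + 1)) (n + 1)"
      by (simp only: fps_deriv_nth of_nat_mult_monom_scalar F_def fps_nth_Abs_fps)
    also have "of_nat (n + 1) * f $ (n + 1) = (\<Sum>j=0..n. fps_deriv g $ j * f $ (n - j))"
      using arg_cong[OF fg, of "\<lambda>h. h $ n"] by (simp only: fps_deriv_nth[of f] fps_mult_nth)
    also have "monom_scalar \<dots> (n + 1) = (G * F) $ n"
      unfolding monom_scalar_sum fps_mult_nth
      by (rule sum.cong) (simp_all add: G_def F_def monom_scalar_mult del: fps_deriv_nth)
    finally show "fps_deriv F $ n = (G * F) $ n" .
  qed
  have dM': "fps_deriv ?M = D * ?M"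
    by (simp only: D_def fps_deriv_const_coeffs dM const_coeffs_mult)
  have rel: "?M * ?P = F * ?P * ?M"
  proof (rule fps_ext, rule fps_ext)
    fix a n
    \<comment> \<open>Terms with j > n vanish, since a multiple of w^j contributes nothing to
      w^n.\<close>
    have "(F * (?P * ?M)) $ a $ n
        = (\<Sum>j=0..a. if n < j then 0 else scale (f $ j) (P $ (n - j) * M $ (a - j)))"
      unfolding fps_mult_nth[of F] fps_sum_nth by (simp add: F_def monom_scalar_mult_nth cong: if_cong)
    also have "\<dots> = (\<Sum>j=0..min a n. scale (f $ j) (P $ (n - j) * M $ (a - j)))"
      by (rule sum.mono_neutral_cong_right) auto
    finally show "(?M * ?P) $ a $ n = (F * ?P * ?M) $ a $ n"
      by (simp add: exch mult.assoc)
  qed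
  \<comment> \<open>The z-derivative of \<open>?M * ?P\<close> is computed directly and through
    \<open>rel\<close>, with \<open>?P\<close> constant in z. The central \<open>F\<close> is moved
    so that first \<open>?M\<close> and then \<open>F\<close> can be cancelled on the right.\<close>
  have "D * ?P * F * ?M = D * (F * ?P * ?M)"
    by (simp only: mult.assoc F_central)
  also have "\<dots> = D * ?M * ?P"
    by (simp only: rel mult.assoc)
  also have "\<dots> = fps_deriv (?M * ?P)"
    by (simp add: dM')
  also have "\<dots> = F * ?P * (D * ?M) + G * F * ?P * ?M"
    by (simp only: rel) (simp add: dM' dF)
  also have "\<dots> = (?P * D + G * ?P) * F * ?M"
    by (simp only: mult.assoc F_central distrib_right)
  finally have "D * ?P * F = (?P * D + G * ?P) * F"
    by (rule fps_mult_cancel_right) (simp add: M0)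
  then have "D * ?P = ?P * D + G * ?P"
    by (rule fps_mult_cancel_right) (simp add: F_def f0 monom_scalar_def)
  from arg_cong[OF this, of "\<lambda>h. h $ a"] show ?thesis
    by (simp add: D_def G_def fps_deriv_const_coeffs del: fps_deriv_nth)
qed

text \<open>After \<open>exchange_deriv\<close> the same method is used in w: \<open>x\<close> is a
  single z-coefficient of the derivative of \<open>A\<close>, hence constant in w, and cancelling
  \<open>P\<close> leaves only the scalar derivative of \<open>c\<close>.\<close>

lemma commutator_of_exchange_relation:
  fixes A B :: "'a fps" and f g :: "complex fps"
  defines "M \<equiv> alg_fps_exp scale A" and "P \<equiv> alg_fps_exp scale B"
  assumes A0: "A $ 0 = 0" and B0: "B $ 0 = 0"
    and commA: "\<And>i j. A $ i * A $ j = A $ j * A $ i"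
    and commB: "\<And>i j. B $ i * B $ j = B $ j * B $ i"
    and exch: "\<And>a n. M $ a * P $ n = (\<Sum>j=0..min a n. scale (f $ j) (P $ (n - j) * M $ (a - j)))"
    and fg: "fps_deriv f = fps_deriv g * f" and f0: "f $ 0 = 1"
  shows "A $ Suc a * B $ Suc b - B $ Suc b * A $ Suc a = scale (if a = b then g $ Suc a else 0) 1"
proof -
  have dP: "fps_deriv P = fps_deriv B * P"
    unfolding P_def by (rule fps_deriv_alg_fps_exp[OF B0 commB])
  define x where "x = fps_const (fps_deriv A $ a)"
  define c where "c = monom_scalar (fps_deriv g $ a) (Suc a)"
  define E where "E = fps_deriv B"
  have x_const: "fps_deriv x = 0"
    by (simp add: x_def)
  have xP: "x * P = P * x + c * P"
    unfolding x_def c_def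
    by (rule exchange_deriv[OF _ _ exch fg f0])
       (simp_all only: M_def alg_fps_exp_zeroth fps_deriv_alg_fps_exp[OF A0 commA])
  have "x * E * P = fps_deriv (x * P)"
    by (simp add: x_const dP E_def mult.assoc)
  also have "\<dots> = E * (P * x) + c * E * P + fps_deriv c * P"
    unfolding xP by (simp add: x_const dP E_def mult.assoc)
  also have "P * x = x * P - c * P"
    by (simp add: xP)
  also have "E * (x * P - c * P) + c * E * P + fps_deriv c * P = (E * x + fps_deriv c) * P"
    unfolding c_def monom_scalar_central[of _ _ E]
    by (simp add: algebra_simps del: fps_deriv_nth)
  finally have "x * E = E * x + fps_deriv c"
    by (rule fps_mult_cancel_right) (simp add: P_def alg_fps_exp_zeroth)
  then have "(x * E - E * x) $ b = fps_deriv c $ b"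
    by simp
  \<comment> \<open>On the left, differentiation supplies a + 1 from \<open>A\<close> and b + 1 from
    \<open>B\<close>. On the right, \<open>c\<close> is a monomial of degree a + 1, so its
    derivative has a coefficient only at b = a.\<close>
  then have "scale (of_nat (Suc a) * of_nat (Suc b))
        (A $ Suc a * B $ Suc b - B $ Suc b * A $ Suc a)
      = scale (of_nat (Suc a) * of_nat (Suc b)) (scale (if a = b then g $ Suc a else 0) 1)"
    by (simp add: x_def E_def c_def monom_scalar_nth of_nat_mult_eq_scale scale_mult_left
        scale_mult_right scale_right_diff_distrib mult.commute mult.left_commute
        del: of_nat_Suc split: if_splits)
  then show ?thesis
    unfolding scale_cancel_left by (simp del: of_nat_Suc)
qed

end

section \<open>The logarithmic derivative of the structure function\<close>

text \<open>Used with $y = q^k$ and $b = q^2$: then $f(x)$ is the structure function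
  $(1 - q^{2k+2} x)(1 - q^{-2k-2} x) / ((1 - q^2 x)(1 - q^{-2} x))$.\<close>

lemma structure_function_log_deriv:
  fixes y b :: complex
  assumes y: "y \<noteq> 0" and b: "b \<noteq> 0" "b\<^sup>2 \<noteq> 1"
  defines "f \<equiv> Abs_fps (\<lambda>j. if j = 0 then 1
      else - ((y - 1 / y) * (y * b - 1 / (y * b)) * ((b ^ j - 1 / b ^ j) / (b - 1 / b))))"
    and "g \<equiv> Abs_fps (\<lambda>j. - ((y ^ j - 1 / y ^ j) * ((y * b) ^ j - 1 / (y * b) ^ j) / of_nat j))"
  shows "fps_deriv f = fps_deriv g * f"
proof -
  define a where "a = y * (y * b)"
  define lin where "lin u = 1 - fps_const u * fps_X" for u :: complex
  define geo where "geo u = Abs_fps (\<lambda>n. u ^ n)" for u :: complex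
  \<comment> \<open>This is u / (1 - u x), minus the logarithmic derivative of
    \<open>lin u\<close>.\<close>
  define dlog where "dlog u = fps_const u * geo u" for u
  have lin_geo: "lin u * geo u = 1" for u
  proof (rule fps_ext)
    fix n
    show "(lin u * geo u) $ n = (1 :: complex fps) $ n"
      by (cases n) (simp_all add: lin_def geo_def left_diff_distrib mult.assoc)
  qed
  have deriv_lin: "fps_deriv (lin u) = - dlog u * lin u" for u
    using lin_geo[of u] by (simp add: lin_def dlog_def mult.assoc mult.commute)
  have lin_lin: "lin u * lin (1 / u) = 1 - fps_const (u + 1 / u) * fps_X + fps_X ^ 2"
    if "u \<noteq> 0" for u
  proof -
    have "fps_const u * fps_X * (fps_const (1 / u) * fps_X)
        = fps_const u * fps_const (1 / u) * fps_X ^ 2"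
      by (simp only: power2_eq_square ac_simps)
    also have "\<dots> = fps_X ^ 2"
      using that by simp
    finally show ?thesis
      by (simp add: lin_def algebra_simps flip: fps_const_add)
  qed
  have nz: "b - 1 / b \<noteq> 0" "a \<noteq> 0"
    using b y by (auto simp: a_def field_simps power2_eq_square)
  define D where "D = lin b * lin (1 / b)"
  define N where "N = lin a * lin (1 / a)"
  define \<kappa> where "\<kappa> = (y - 1 / y) * (y * b - 1 / (y * b))"
  have \<kappa>: "\<kappa> = a + 1 / a - (b + 1 / b)"
    using y b by (simp add: \<kappa>_def a_def field_simps)
  \<comment> \<open>Partial fractions of N / D; the two geometric series have equal constant terms,
    so the right side also starts with 1.\<close>
  have f_eq: "f = 1 - fps_const (\<kappa> / (b - 1 / b)) * (geo b - geo (1 / b))"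
    by (rule fps_ext) (simp add: f_def geo_def \<kappa>_def power_one_over)
  have "f * D = D - fps_const (\<kappa> / (b - 1 / b)) * ((lin b * geo b) * lin (1 / b)
      - (lin (1 / b) * geo (1 / b)) * lin b)"
    by (subst f_eq) (simp add: D_def algebra_simps)
  also have "\<dots> = D - fps_const (\<kappa> / (b - 1 / b)) * (fps_const (b - 1 / b) * fps_X)"
    unfolding lin_geo by (simp add: lin_def algebra_simps flip: fps_const_sub)
  also have "\<dots> = D - fps_const \<kappa> * fps_X"
    using nz by (simp flip: mult.assoc)
  also have "\<dots> = N"
    unfolding D_def N_def lin_lin[OF b(1)] lin_lin[OF nz(2)] \<kappa>
    by (simp add: algebra_simps flip: fps_const_add fps_const_sub)
  finally have fD: "f * D = N" .
  have dD: "fps_deriv D = - (dlog b + dlog (1 / b)) * D"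
    unfolding D_def by (simp only: fps_deriv_mult deriv_lin) (simp add: algebra_simps)
  have dN: "fps_deriv N = - (dlog a + dlog (1 / a)) * N"
    unfolding N_def by (simp only: fps_deriv_mult deriv_lin) (simp add: algebra_simps)
  have dg: "fps_deriv g = dlog b + dlog (1 / b) - (dlog a + dlog (1 / a))"
  proof (rule fps_ext)
    fix n
    \<comment> \<open>This is the identity for \<open>\<kappa>\<close> with \<open>y\<close> and
      \<open>b\<close> replaced by their m-th powers. The factor \<open>Suc n\<close> from
      differentiation cancels the denominator in \<open>g\<close>.\<close>
    have "- ((y ^ m - 1 / y ^ m) * ((y * b) ^ m - 1 / (y * b) ^ m))
        = b ^ m + (1 / b) ^ m - (a ^ m + (1 / a) ^ m)" for m
      using y b by (simp add: a_def field_simps power_mult_distrib power_divide)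
    from this[of "Suc n"]
    show "fps_deriv g $ n = (dlog b + dlog (1 / b) - (dlog a + dlog (1 / a))) $ n"
      by (simp add: g_def dlog_def geo_def del: of_nat_Suc)
  qed
  \<comment> \<open>Quotient rule for N / D with denominators cleared; \<open>D\<close> can be
    cancelled since complex power series have no zero divisors.\<close>
  have "D * fps_deriv f = fps_deriv N - f * fps_deriv D"
    by (simp add: fD[symmetric])
  also have "\<dots> = D * (fps_deriv g * f)"
    unfolding dD dN dg by (simp add: fD[symmetric] algebra_simps)
  finally have "D * fps_deriv f = D * (fps_deriv g * f)" .
  moreover have "D $ 0 \<noteq> 0"
    by (simp add: D_def lin_def)
  then have "D \<noteq> 0"
    by auto
  ultimately show ?thesis
    by simp
qed

section \<open>Exchange relations of the normalized generators\<close>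

context svir_K
begin

lemma K0inv_commute:
  assumes "Kp 0 * x = x * Kp 0"
  shows "K0inv * x = x * K0inv"
proof -
  have "K0inv * x = K0inv * (x * Kp 0) * K0inv"
    by (simp add: mult.assoc K0_inverse)
  also have "\<dots> = x * K0inv"
    by (simp add: assms[symmetric] K0_inverse flip: mult.assoc)
  finally show ?thesis .
qed

lemma K0inv_Kp: "K0inv * Kp n = Kp n * K0inv"
  by (rule K0inv_commute) (rule Kp_comm)

lemma K0inv_Km: "K0inv * Km n = Km n * K0inv"
  by (rule K0inv_commute) (simp add: K0_eq Km_comm)

lemma normalized_Kp_commute: "(K0inv * Kp m) * (K0inv * Kp n) = (K0inv * Kp n) * (K0inv * Kp m)"
  by (metis K0inv_Kp Kp_comm mult.assoc)

lemma normalized_Km_commute: "(K0inv * Km m) * (K0inv * Km n) = (K0inv * Km n) * (K0inv * Km m)"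
  by (metis K0inv_Km Km_comm mult.assoc)

text \<open>With \<open>f 0 = 1\<close> the leading term of \<open>Km_Kp\<close> becomes the summand
  j = 0, which gives the relation the form that \<open>exchange_deriv\<close> expects.\<close>

lemma normalized_exchange:
  fixes f :: "nat \<Rightarrow> complex"
  assumes f0: "f 0 = 1"
    and f: "\<And>j. j > 0 \<Longrightarrow> f j = - (q - inverse q)\<^sup>2
        * (qnum l k * qnum l (k + 2) * qnum l (2 * of_nat j) / qnum l 2)"
  shows "(K0inv * Km (- int a)) * (K0inv * Kp (int n))
    = (\<Sum>j=0..min a n. scale (f j) ((K0inv * Kp (int (n - j))) * (K0inv * Km (- int (a - j)))))"
proof -
  let ?c = "\<lambda>j. qnum l k * qnum l (k + 2) * qnum l (2 * of_int j) / qnum l 2"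
  let ?t = "\<lambda>j::int. scale (?c j) (Kp (int n - j) * Km (- int a + j))"
  let ?s = "\<lambda>j::nat. scale (f j) (Kp (int n - int j) * Km (- int (a - j)))"
  have "- scale ((q - inverse q)\<^sup>2) (\<Sum>j\<in>{1..int a}. ?t j)
      = (\<Sum>j\<in>{1..int a}. - scale ((q - inverse q)\<^sup>2) (?t j))"
    by (simp only: scale_sum_right sum_negf)
  also have "\<dots> = (\<Sum>j\<in>{1..a}. ?s j)"
    by (rule sum.reindex_bij_witness[of _ int nat])
       (auto simp: f of_nat_diff algebra_simps simp flip: scale_minus_left)
  finally have "Km (- int a) * Kp (int n) = ?s 0 + (\<Sum>j\<in>{1..a}. ?s j)"
    using Km_Kp[of "- int a" "int n"] by (simp add: f0)
  also have "\<dots> = (\<Sum>j=0..a. ?s j)"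
    by (simp add: sum.atLeast_Suc_atMost)
  \<comment> \<open>\<open>Kp\<close> vanishes at negative indices, so j stops at n and natural
    subtraction agrees with integer subtraction.\<close>
  also have "\<dots> = (\<Sum>j=0..min a n. scale (f j) (Kp (int (n - j)) * Km (- int (a - j))))"
    by (rule sum.mono_neutral_cong_right) (auto simp: Kp_neg of_nat_diff)
  finally have rel: "Km (- int a) * Kp (int n)
    = (\<Sum>j=0..min a n. scale (f j) (Kp (int (n - j)) * Km (- int (a - j))))" .
  have "(K0inv * Km u) * (K0inv * Kp v) = K0inv * K0inv * (Km u * Kp v)"
       "(K0inv * Kp v) * (K0inv * Km u) = K0inv * K0inv * (Kp v * Km u)" for u v
    by (metis K0inv_Kp K0inv_Km mult.assoc)+
  then show ?thesis
    by (simp only: rel sum_distrib_left scale_mult_right)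
qed

end

section \<open>Quantum numbers and the Heisenberg relations\<close>

lemma qpow_nonzero [simp]: "qpow l u \<noteq> 0"
  by (simp add: qpow_def)

lemma qpow_minus: "qpow l (- u) = 1 / qpow l u"
  by (simp add: qpow_def exp_minus inverse_eq_divide)

lemma qpow_add: "qpow l (u + v) = qpow l u * qpow l v"
  by (simp add: qpow_def distrib_right exp_add)

lemma qpow_mult_of_nat: "qpow l (u * of_nat n) = qpow l u ^ n"
  by (simp add: qpow_def mult_ac flip: exp_of_nat_mult)

lemma qnum_eq:
  assumes "exp l = q"
  shows "qnum l u = (qpow l u - 1 / qpow l u) / (q - inverse q)"
  using assms by (simp add: qnum_def qpow_minus) (simp add: qpow_def inverse_eq_divide)

lemma qnum_minus: "qnum l (- u) = - qnum l u"
  by (simp add: qnum_def minus_divide_left)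

theorem proposition1p8:
  fixes scale :: "complex \<Rightarrow> 'a::ring_1 \<Rightarrow> 'a"
    and q l k :: complex
    and Kp Km H :: "int \<Rightarrow> 'a"
    and K0inv :: 'a
  assumes "exp l = q"
    and "norm q \<le> 1"
    and "norm (qpow l k) \<le> 1"
    and "k \<noteq> -2"
    and "\<And>n::nat. n > 0 \<Longrightarrow> q ^ n \<noteq> 1"
    and "svir_K scale q l k Kp Km K0inv"
    and "alg_fps_exp scale
           (Abs_fps (\<lambda>n. if n = 0 then 0 else scale (q - inverse q) (H (int n))))
         = Abs_fps (\<lambda>n. K0inv * Kp (int n))"
    and "alg_fps_exp scale
           (Abs_fps (\<lambda>n. if n = 0 then 0 else scale (q - inverse q) (H (- int n))))
         = Abs_fps (\<lambda>n. K0inv * Km (- int n))"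
  shows "\<forall>m n. m \<noteq> 0 \<longrightarrow> n \<noteq> 0 \<longrightarrow>
           H m * H n - H n * H m
           = scale (if m + n = 0
                    then qnum l ((k + 2) * of_int m) * qnum l (k * of_int m) / of_int m
                    else 0) 1"
proof -
  interpret svir_K scale q l k Kp Km K0inv
    by fact
  define h where "h = q - inverse q"
  \<comment> \<open>\<open>A\<close> carries the negative modes, for K^-, and \<open>B\<close> the
    positive ones, for K^+.\<close>
  define A where "A = Abs_fps (\<lambda>n. if n = 0 then 0 else scale h (H (- int n)))"
  define B where "B = Abs_fps (\<lambda>n. if n = 0 then 0 else scale h (H (int n)))"
  have expA: "alg_fps_exp scale A = Abs_fps (\<lambda>n. K0inv * Km (- int n))"
    and expB: "alg_fps_exp scale B = Abs_fps (\<lambda>n. K0inv * Kp (int n))"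
    unfolding A_def B_def h_def by (rule assms(8), rule assms(7))
  have A0: "A $ 0 = 0" and B0: "B $ 0 = 0"
    by (simp_all add: A_def B_def)
  have commA: "A $ i * A $ j = A $ j * A $ i" for i j
    by (rule commute_coeffs_of_alg_fps_exp_commute[OF A0])
       (simp add: expA normalized_Km_commute)
  have commB: "B $ i * B $ j = B $ j * B $ i" for i j
    by (rule commute_coeffs_of_alg_fps_exp_commute[OF B0])
       (simp add: expB normalized_Kp_commute)
  have q0: "q \<noteq> 0"
    using assms(1) by auto
  \<comment> \<open>The order 2 case makes q - 1/q nonzero, the order 4 case makes [2]
    nonzero.\<close>
  have q2: "q\<^sup>2 \<noteq> 1" and q4: "(q\<^sup>2)\<^sup>2 \<noteq> 1"
    using assms(5)[of 2] assms(5)[of 4] by (simp_all flip: power_mult)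
  have h0: "h \<noteq> 0"
    using q0 q2 by (auto simp: h_def field_simps power2_eq_square)
  define y where "y = qpow l k"
  define b where "b = q\<^sup>2"
  have y0: "y \<noteq> 0" and b0: "b \<noteq> 0"
    using q0 by (simp_all add: y_def b_def)
  have pow_2: "qpow l 2 = b"
    using assms(1) exp_of_nat_mult[of 2 l] by (simp add: qpow_def b_def)
  have qnum_2: "qnum l (2 * of_nat j) = (b ^ j - 1 / b ^ j) / h" for j
    by (simp add: qnum_eq[OF assms(1)] qpow_mult_of_nat pow_2 h_def)
  have qnum_k: "qnum l (k * of_nat j) = (y ^ j - 1 / y ^ j) / h" for j
    by (simp add: qnum_eq[OF assms(1)] qpow_mult_of_nat y_def h_def)
  have qnum_k2: "qnum l ((k + 2) * of_nat j) = ((y * b) ^ j - 1 / (y * b) ^ j) / h" for j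
    by (simp add: qnum_eq[OF assms(1)] qpow_mult_of_nat qpow_add pow_2 y_def h_def)
  define f where "f = Abs_fps (\<lambda>j. if j = 0 then 1
      else - ((y - 1 / y) * (y * b - 1 / (y * b)) * ((b ^ j - 1 / b ^ j) / (b - 1 / b))))"
  define g where
    "g = Abs_fps (\<lambda>j. - ((y ^ j - 1 / y ^ j) * ((y * b) ^ j - 1 / (y * b) ^ j) / of_nat j))"
  have fg: "fps_deriv f = fps_deriv g * f"
    unfolding f_def g_def by (rule structure_function_log_deriv) (use y0 b0 q4 b_def in auto)
  \<comment> \<open>The four quantum numbers contribute 1 / h^2 in total, which cancels the square
    of q - 1/q.\<close>
  have f_nth: "f $ j = - (q - inverse q)\<^sup>2
      * (qnum l k * qnum l (k + 2) * qnum l (2 * of_nat j) / qnum l 2)" if "j > 0" for j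
    using that h0 qnum_k[of 1] qnum_k2[of 1] qnum_2[of 1] qnum_2[of j]
    by (simp add: f_def power2_eq_square flip: h_def)
  have f0: "f $ 0 = 1"
    by (simp add: f_def)
  have exch: "alg_fps_exp scale A $ a * alg_fps_exp scale B $ n
      = (\<Sum>j=0..min a n. scale (f $ j) (alg_fps_exp scale B $ (n - j) * alg_fps_exp scale A $ (a - j)))"
    for a n
    unfolding expA expB fps_nth_Abs_fps by (rule normalized_exchange[OF f0 f_nth])
  have mixed: "H (- int i) * H (int j) - H (int j) * H (- int i)
      = scale (if i = j then - (qnum l ((k + 2) * of_nat i) * qnum l (k * of_nat i) / of_nat i) else 0) 1"
    if ij: "i > 0" "j > 0" for i j
  proof -
    \<comment> \<open>The commutator lemma is indexed by successors, hence its use at i - 1 and j -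
      1.\<close>
    have "A $ i * B $ j - B $ j * A $ i = scale (if i = j then g $ i else 0) 1"
      using commutator_of_exchange_relation[OF A0 B0 commA commB exch fg f0, of "i - 1" "j - 1"] ij
      by (simp split: if_splits)
    moreover have "A $ i * B $ j - B $ j * A $ i
        = scale (h * h) (H (- int i) * H (int j) - H (int j) * H (- int i))"
      using ij by (simp add: A_def B_def scale_mult_left scale_mult_right scale_right_diff_distrib)
    moreover have "g $ i = h * h * - (qnum l ((k + 2) * of_nat i) * qnum l (k * of_nat i) / of_nat i)"
      unfolding qnum_k qnum_k2 using h0 by (simp add: g_def mult.commute)
    ultimately have "scale (h * h) (H (- int i) * H (int j) - H (int j) * H (- int i))
      = scale (h * h) (scale (if i = j
          then - (qnum l ((k + 2) * of_nat i) * qnum l (k * of_nat i) / of_nat i) else 0) 1)"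
      by (cases "i = j") simp_all
    then show ?thesis
      unfolding scale_cancel_left using h0 by simp
  qed
  have same_sign: "H m * H n = H n * H m" if "m > 0 \<and> n > 0 \<or> m < 0 \<and> n < 0" for m n
  proof -
    have "scale (h * h) (H m * H n) = scale (h * h) (H n * H m)"
      using that commB[of "nat m" "nat n"] commA[of "nat (- m)" "nat (- n)"]
      by (auto simp: A_def B_def scale_mult_left scale_mult_right)
    then show ?thesis
      unfolding scale_cancel_left using h0 by simp
  qed
  show ?thesis
  proof (intro allI impI)
    fix m n :: int
    assume "m \<noteq> 0" "n \<noteq> 0"
    then consider "m > 0 \<and> n > 0 \<or> m < 0 \<and> n < 0" | "m < 0" "n > 0" | "m > 0" "n < 0"
      by linarith
    then show "H m * H n - H n * H m = scale (if m + n = 0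
        then qnum l ((k + 2) * of_int m) * qnum l (k * of_int m) / of_int m else 0) 1"
    proof cases
      case 1
      then show ?thesis
        using same_sign[OF 1] by auto
    next
      case 2
      then obtain i j where "m = - int i" "n = int j" "i > 0" "j > 0"
        by (metis neg_int_cases pos_int_cases)
      \<comment> \<open>As \<open>qnum\<close> is odd, the two signs in the product cancel; the
        minus sign comes from dividing by m = -i.\<close>
      then show ?thesis
        using mixed[of i j] by (auto simp: qnum_minus)
    next
      case 3
      then obtain i j where "n = - int i" "m = int j" "i > 0" "j > 0"
        by (metis neg_int_cases pos_int_cases)
      then show ?thesis
        using arg_cong[OF mixed[of i j], of uminus] by (auto simp flip: scale_minus_left)
    qed
  qed
qed

end
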